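(* Let $f(r)=\mathrm dF(r)/\mathrm dr$, $c>0$, $\alpha=2$ and $\|y_0\|>0$. If $F(r)\sim \frac{1}{r^{\nu}}$ as $r\to\infty$ for some $\nu>0$, then $$\mathbb{E}[\mathsf I(y_0)]=\lambda A_2(y_0,c)<\infty,$$ where $A_2(y_0,c)$ is given by $$A_2(y_0,c)=-\pi\left(F(0)\,\operatorname{asinh}\frac{c-\|y_0\|^2}{2\|y_0\|\sqrt c}+\int_0^\infty f(r)\,\operatorname{asinh}\frac{r^2+c-\|y_0\|^2}{2\|y_0\|\sqrt c}\,\mathrm dr\right).$$
   Context: $\Phi$ is an isotropic Poisson point process on $\mathbb{R}^2$ with intensity function $\lambda(x)=\lambda F(\|x\|)$, where $0<\lambda<\infty$ is a constant and $F:[0,\infty)\to[0,1]$ is the shape function. The points $\mathsf x$ of $\Phi$ (interferers) carry i.i.d. power fading coefficients $\mathsf g_{\mathsf x}\ge0$ of arbitrary distribution, independent of $\Phi$, with $\mathbb{E}[\mathsf g_{\mathsf x}]=1$. The path loss function is $\ell(r)=(c+r^{\alpha})^{-1}$. The interference at the receiver location $y_0\in\mathbb{R}^2$ is $\mathsf I(y_0)=\sum_{\mathsf x\in\Phi}\mathsf g_{\mathsf x}\,\ell(\|\mathsf x-y_0\|)$. The notation $F(r)\sim 1/r^{\nu}$ as $r\to\infty$ means $0<\lim_{r\to\infty}F(r)r^{\nu}<\infty$. *)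

theory Defs
  imports "HOL-Probability.Probability"
begin

text \<open>
  A point process is represented by its random set of points \<open>\<Phi>\<close>, which loses nothing here:
  a Poisson process whose intensity measure has a density is almost surely simple.  The
  local finiteness clause makes \<open>card\<close> the true number of points in a bounded set.
\<close>

definition poisson_point_process ::
  "'w measure \<Rightarrow> ('w \<Rightarrow> 'a::euclidean_space set) \<Rightarrow> 'a measure \<Rightarrow> bool" where
  "poisson_point_process M \<Phi> \<Lambda> \<longleftrightarrow>
     sets \<Lambda> = sets borel \<and>
     (\<forall>B\<in>sets borel. bounded B \<longrightarrow> emeasure \<Lambda> B < \<infinity>) \<and>
     (\<forall>\<omega>\<in>space M. \<forall>B. bounded B \<longrightarrow> finite (\<Phi> \<omega> \<inter> B)) \<and>
     (\<forall>B\<in>sets borel. bounded B \<longrightarrow>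
        (\<lambda>\<omega>. card (\<Phi> \<omega> \<inter> B)) \<in> M \<rightarrow>\<^sub>M count_space UNIV \<and>
        (\<forall>k. measure M {\<omega>\<in>space M. card (\<Phi> \<omega> \<inter> B) = k} =
             exp (- measure \<Lambda> B) * measure \<Lambda> B ^ k / fact k)) \<and>
     (\<forall>\<B>. finite \<B> \<longrightarrow> \<B> \<subseteq> {B \<in> sets borel. bounded B} \<longrightarrow> disjoint \<B> \<longrightarrow>
        prob_space.indep_vars M (\<lambda>_. count_space UNIV) (\<lambda>B \<omega>. card (\<Phi> \<omega> \<inter> B)) \<B>)"

definition isotropic_intensity :: "real \<Rightarrow> (real \<Rightarrow> real) \<Rightarrow> (real^2) measure" where
  "isotropic_intensity lam F = density lborel (\<lambda>x. ennreal (lam * F (norm x)))"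

text \<open>
  Independent marking.  The family of marks at all locations of the plane is uncountable, and
  evaluating such a family at random points raises measurability problems; so, as usual, the
  points are enumerated measurably (there may be finitely many of them) and carry an i.i.d.
  sequence \<open>G\<close> that is independent of the enumerated points.  It would not be enough for \<open>G\<close>
  to be independent of the set \<open>\<Phi>\<close>, since the enumeration could then depend on \<open>G\<close>.
  The values of \<open>g \<omega>\<close> outside \<open>\<Phi> \<omega>\<close> are irrelevant.
\<close>

definition iid_marks ::
  "'w measure \<Rightarrow> ('w \<Rightarrow> 'a::euclidean_space set) \<Rightarrow> ('w \<Rightarrow> 'a \<Rightarrow> real) \<Rightarrow> real measure \<Rightarrow> bool" where
  "iid_marks M \<Phi> g Q \<longleftrightarrow>
     (\<exists>(N :: 'w \<Rightarrow> enat) (X :: nat \<Rightarrow> 'w \<Rightarrow> 'a) (G :: nat \<Rightarrow> 'w \<Rightarrow> real).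
        N \<in> M \<rightarrow>\<^sub>M count_space UNIV \<and>
        (\<forall>n. X n \<in> M \<rightarrow>\<^sub>M borel) \<and>
        (\<forall>\<omega>\<in>space M. bij_betw (\<lambda>n. X n \<omega>) {n. enat n < N \<omega>} (\<Phi> \<omega>)) \<and>
        (\<forall>\<omega>\<in>space M. \<forall>n. enat n < N \<omega> \<longrightarrow> g \<omega> (X n \<omega>) = G n \<omega>) \<and>
        prob_space.indep_vars M (\<lambda>_. borel) G UNIV \<and>
        (\<forall>n. distr M borel (G n) = Q) \<and>
        prob_space.indep_set M
          (sets (vimage_algebra (space M) (\<lambda>\<omega>. (N \<omega>, \<lambda>n. X n \<omega>))
                   (count_space UNIV \<Otimes>\<^sub>M (\<Pi>\<^sub>M n\<in>UNIV. borel))))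
          (sets (vimage_algebra (space M) (\<lambda>\<omega> n. G n \<omega>) (\<Pi>\<^sub>M n\<in>UNIV. borel))))"

definition path_loss :: "real \<Rightarrow> real \<Rightarrow> real \<Rightarrow> real" where
  "path_loss c \<alpha> r = inverse (c + r powr \<alpha>)"

text \<open>The interference takes values in \<open>[0, \<infinity>]\<close>, so that the sum always exists.\<close>

definition interference ::
  "('w \<Rightarrow> (real^2) set) \<Rightarrow> ('w \<Rightarrow> real^2 \<Rightarrow> real) \<Rightarrow> (real \<Rightarrow> real) \<Rightarrow> real^2 \<Rightarrow> 'w \<Rightarrow> ennreal" where
  "interference \<Phi> g l y \<omega> = (\<Sum>\<^sub>\<infinity>x\<in>\<Phi> \<omega>. ennreal (g \<omega> x * l (norm (x - y))))"

text \<open>\<open>F(r) \<sim> 1/r\<^sup>\<nu>\<close> as \<open>r \<rightarrow> \<infinity>\<close>, up to a positive constant.\<close>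

definition decays_like_power :: "(real \<Rightarrow> real) \<Rightarrow> real \<Rightarrow> bool" where
  "decays_like_power F \<nu> \<longleftrightarrow> (\<exists>L>0. ((\<lambda>r. F r * r powr \<nu>) \<longlongrightarrow> L) at_top)"

definition A2_integrand :: "(real \<Rightarrow> real) \<Rightarrow> real^2 \<Rightarrow> real \<Rightarrow> real \<Rightarrow> real" where
  "A2_integrand f y c r =
     f r * arsinh ((r\<^sup>2 + c - (norm y)\<^sup>2) / (2 * norm y * sqrt c))"

text \<open>
  The integral is the Henstock--Kurzweil integral: on \<open>{0..}\<close> it agrees with the improper
  integral, which need not converge absolutely since \<open>F\<close> need not be monotone.
\<close>

definition A2 :: "(real \<Rightarrow> real) \<Rightarrow> (real \<Rightarrow> real) \<Rightarrow> real^2 \<Rightarrow> real \<Rightarrow> real" where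
  "A2 F f y c =
     - pi * (F 0 * arsinh ((c - (norm y)\<^sup>2) / (2 * norm y * sqrt c))
             + integral {0..} (A2_integrand f y c))"

end

theory Submission
  imports Defs "HOL-Real_Asymp.Real_Asymp"
begin

text \<open>
  Since the marks have mean one and are independent of the enumerated points, Campbell's formula
  gives the mean interference as \<open>\<lambda> \<integral> F(\<parallel>x\<parallel>) / (c + \<parallel>x - y\<^sub>0\<parallel>\<^sup>2) dx\<close>.  Lebesgue measure is rotation
  invariant, so the kernel may be averaged over all rotations; with \<open>R = \<parallel>y\<^sub>0\<parallel>\<close> its average over the
  circle of radius \<open>r\<close> is \<open>1 / sqrt ((c + r\<^sup>2 + R\<^sup>2)\<^sup>2 - 4 r\<^sup>2 R\<^sup>2)\<close>.  The radicand equals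
  \<open>(r\<^sup>2 + c - R\<^sup>2)\<^sup>2 + 4 R\<^sup>2 c\<close>, so the resulting radial integral is \<open>\<pi> \<integral> F h'\<close> where
  \<open>h(r) = arsinh ((r\<^sup>2 + c - R\<^sup>2) / (2 R sqrt c))\<close>.  As \<open>h\<close> grows logarithmically and \<open>F\<close> decays like a
  power, \<open>F h' = O(r\<^bsup>-1-\<nu>\<^esup>)\<close> is integrable and \<open>F h \<longlongrightarrow> 0\<close>, and integration by parts (in the
  Henstock--Kurzweil sense) concludes.
\<close>

subsection \<open>Mean interference\<close>

text \<open>Events about \<open>p (U \<omega>)\<close> lie in the sigma-algebra generated by
  \<open>U\<close>, and likewise for \<open>V\<close>, so independence of the generated
  sigma-algebras passes to the \<open>ennreal\<close>-valued variables. This later separates the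
  marks from the enumerated points.\<close>

lemma (in prob_space) nn_integral_mult_indep_set:
  fixes p :: "'b \<Rightarrow> ennreal" and q :: "'c \<Rightarrow> ennreal"
  assumes indep: "indep_set (sets (vimage_algebra (space M) U S)) (sets (vimage_algebra (space M) V T))"
    and [measurable]: "U \<in> M \<rightarrow>\<^sub>M S" "V \<in> M \<rightarrow>\<^sub>M T" "p \<in> borel_measurable S" "q \<in> borel_measurable T"
  shows "(\<integral>\<^sup>+\<omega>. p (U \<omega>) * q (V \<omega>) \<partial>M) = (\<integral>\<^sup>+\<omega>. p (U \<omega>) \<partial>M) * (\<integral>\<^sup>+\<omega>. q (V \<omega>) \<partial>M)"
proof -
  \<comment> \<open>\<open>indep_var\<close> requires both variables to have the same type, so independence is transferred
    to the \<open>ennreal\<close>-valued variables by hand.\<close>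
  have "indep_sets (case_bool (sigma_sets (space M) {(p \<circ> U) -` A \<inter> space M |A. A \<in> sets borel})
      (sigma_sets (space M) {(q \<circ> V) -` A \<inter> space M |A. A \<in> sets borel})) UNIV"
  proof (rule indep_sets_mono_sets[OF indep[unfolded indep_set_def]])
    fix b :: bool
    have sub: "sigma_sets (space M) {(h \<circ> W) -` A \<inter> space M |A. A \<in> sets borel}
        \<subseteq> sets (vimage_algebra (space M) W R)"
      if "W \<in> M \<rightarrow>\<^sub>M R" "h \<in> borel_measurable R" for h :: "'d \<Rightarrow> ennreal" and W R
    proof (rule sets.sigma_sets_subset[of _ "vimage_algebra (space M) W R", simplified], safe)
      fix A :: "ennreal set" assume "A \<in> sets borel"
      then have "h -` A \<inter> space R \<in> sets R"
        using that(2) by (intro measurable_sets)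
      moreover have "(h \<circ> W) -` A \<inter> space M = W -` (h -` A \<inter> space R) \<inter> space M"
        using measurable_space[OF that(1)] by auto
      ultimately show "(h \<circ> W) -` A \<inter> space M \<in> sets (vimage_algebra (space M) W R)"
        by (simp only: in_vimage_algebra)
    qed
    show "case_bool (sigma_sets (space M) {(p \<circ> U) -` A \<inter> space M |A. A \<in> sets borel})
        (sigma_sets (space M) {(q \<circ> V) -` A \<inter> space M |A. A \<in> sets borel}) b
      \<subseteq> case_bool (sets (vimage_algebra (space M) U S)) (sets (vimage_algebra (space M) V T)) b"
      by (cases b) (simp_all only: bool.case sub[OF assms(2,4)] sub[OF assms(3,5)])
  qed
  then have "indep_var borel (p \<circ> U) borel (q \<circ> V)"
    by (simp add: indep_var_eq indep_set_def)
  \<comment> \<open>\<open>indep_var\<close> carries its target spaces as a \<open>case_bool\<close>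
    family; the product rule below needs them in constant form.\<close>
  then have "indep_vars (\<lambda>_. borel) (case_bool (p \<circ> U) (q \<circ> V)) UNIV"
    unfolding indep_var_def by (rule indep_vars_cong[THEN iffD1, rotated -1]) (auto split: bool.split)
  from indep_vars_nn_integral[OF _ this] show ?thesis
    by (simp add: UNIV_bool mult.commute comp_def)
qed

text \<open>In \<open>ennreal\<close> every family is summable, so the unordered sum is a series,
  which can be integrated term by term.\<close>

lemma infsum_eq_suminf_indicator:
  fixes h :: "nat \<Rightarrow> ennreal"
  shows "infsum h A = (\<Sum>n. h n * indicator A n)"
proof -
  have "infsum h A = infsum (\<lambda>n. h n * indicator A n) UNIV"
    by (rule infsum_cong_neutral) auto
  also have "(\<lambda>n. h n * indicator A n) summable_on UNIV"
    by (rule nonneg_summable_on_complete) simp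
  then have "infsum (\<lambda>n. h n * indicator A n) UNIV = (\<Sum>n. h n * indicator A n)"
    by (intro sums_unique has_sum_imp_sums has_sum_infsum)
  finally show ?thesis .
qed

section \<open>Poisson counts and Campbell's formula\<close>

text \<open>At index \<open>Suc k\<close> the factor \<open>Suc k\<close> cancels against the
  factorial and leaves \<open>m * exp (- m)\<close> times the exponential series; the term of index
  0 vanishes.\<close>

lemma poisson_mean_suminf:
  fixes m :: real
  assumes "0 \<le> m"
  shows "(\<Sum>k. of_nat k * ennreal (exp (- m) * m ^ k / fact k)) = ennreal m"
proof -
  have "(\<lambda>k. m * exp (- m) * (m ^ k /\<^sub>R fact k)) sums (m * exp (- m) * exp m)"
    by (intro sums_mult exp_converges)
  moreover have "m * exp (- m) * (m ^ k /\<^sub>R fact k) = real (Suc k) * (exp (- m) * m ^ Suc k / fact (Suc k))" for k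
  proof -
    have "real (Suc k) / fact (Suc k) = 1 / fact k"
      by (simp del: of_nat_Suc)
    moreover have "real (Suc k) * (exp (- m) * m ^ Suc k / fact (Suc k))
        = real (Suc k) / fact (Suc k) * (exp (- m) * m ^ Suc k)"
      by (simp only: divide_inverse mult_ac)
    ultimately show ?thesis
      by (simp only:) (simp add: divide_inverse mult_ac)
  qed
  ultimately have "(\<lambda>k. real (Suc k) * (exp (- m) * m ^ Suc k / fact (Suc k))) sums m"
    by (simp only: mult.assoc exp_minus_inverse exp_minus left_inverse exp_not_eq_zero mult_1_right not_False_eq_True)
  then have "(\<lambda>k. real k * (exp (- m) * m ^ k / fact k)) sums m"
    by (subst (asm) sums_Suc_iff) simp
  then have "(\<Sum>k. ennreal (real k * (exp (- m) * m ^ k / fact k))) = ennreal m"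
    using assms by (intro suminf_ennreal_eq) auto
  moreover have "ennreal (real k * (exp (- m) * m ^ k / fact k)) = of_nat k * ennreal (exp (- m) * m ^ k / fact k)" for k
    by (simp only: ennreal_mult' of_nat_0_le_iff ennreal_of_nat_eq_real_of_nat)
  ultimately show ?thesis
    by simp
qed

text \<open>The count is decomposed over its level sets, whose probabilities are the Poisson
  weights.\<close>

lemma poisson_point_process_mean:
  assumes "prob_space M" "poisson_point_process M \<Phi> \<Lambda>" "B \<in> sets borel" "bounded B"
  shows "(\<integral>\<^sup>+\<omega>. of_nat (card (\<Phi> \<omega> \<inter> B)) \<partial>M) = emeasure \<Lambda> B"
proof -
  interpret prob_space M by fact
  have fin: "emeasure \<Lambda> B < \<infinity>"
    and [measurable]: "(\<lambda>\<omega>. card (\<Phi> \<omega> \<inter> B)) \<in> M \<rightarrow>\<^sub>M count_space UNIV"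
    and law: "\<And>k. measure M {\<omega>\<in>space M. card (\<Phi> \<omega> \<inter> B) = k}
                = exp (- measure \<Lambda> B) * measure \<Lambda> B ^ k / fact k"
    using assms(2-4) unfolding poisson_point_process_def by blast+
  have "(\<integral>\<^sup>+\<omega>. of_nat (card (\<Phi> \<omega> \<inter> B)) \<partial>M)
      = (\<integral>\<^sup>+\<omega>. (\<Sum>k. of_nat k * indicator {\<omega>\<in>space M. card (\<Phi> \<omega> \<inter> B) = k} \<omega>) \<partial>M)"
  proof (rule nn_integral_cong)
    fix \<omega> assume "\<omega> \<in> space M"
    then have "(\<Sum>k. of_nat k * indicator {\<omega>\<in>space M. card (\<Phi> \<omega> \<inter> B) = k} \<omega> :: ennreal)
        = (\<Sum>k\<in>{card (\<Phi> \<omega> \<inter> B)}. of_nat k * indicator {\<omega>\<in>space M. card (\<Phi> \<omega> \<inter> B) = k} \<omega>)"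
      by (intro suminf_finite) auto
    with \<open>\<omega> \<in> space M\<close> show "of_nat (card (\<Phi> \<omega> \<inter> B))
        = (\<Sum>k. of_nat k * indicator {\<omega>\<in>space M. card (\<Phi> \<omega> \<inter> B) = k} \<omega> :: ennreal)"
      by simp
  qed
  also have "\<dots> = (\<Sum>k. of_nat k * emeasure M {\<omega>\<in>space M. card (\<Phi> \<omega> \<inter> B) = k})"
    by (subst nn_integral_suminf) (auto simp: nn_integral_cmult)
  also have "\<dots> = (\<Sum>k. of_nat k * ennreal (exp (- measure \<Lambda> B) * measure \<Lambda> B ^ k / fact k))"
    by (simp add: emeasure_eq_measure law)
  also have "\<dots> = ennreal (measure \<Lambda> B)"
    by (rule poisson_mean_suminf) simp
  also have "\<dots> = emeasure \<Lambda> B"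
    using fin by (simp add: emeasure_eq_ennreal_measure)
  finally show ?thesis .
qed

text \<open>Both sides integrate \<open>k\<close>, the left one against the mean measure
  \<open>\<mu>\<close> of the enumerated points. By the Poisson mean, \<open>\<mu>\<close> and
  \<open>\<Lambda>\<close> agree and are finite on open boxes, which form an intersection-stable
  generator and exhaust the space; hence the measures coincide.\<close>

lemma poisson_point_process_campbell:
  fixes \<Phi> :: "'w \<Rightarrow> 'a::euclidean_space set" and N :: "'w \<Rightarrow> enat" and X :: "nat \<Rightarrow> 'w \<Rightarrow> 'a"
  assumes "prob_space M" and ppp: "poisson_point_process M \<Phi> \<Lambda>"
    and [measurable]: "N \<in> M \<rightarrow>\<^sub>M count_space UNIV" "\<And>n. X n \<in> M \<rightarrow>\<^sub>M borel"
    and bij: "\<And>\<omega>. \<omega> \<in> space M \<Longrightarrow> bij_betw (\<lambda>n. X n \<omega>) {n. enat n < N \<omega>} (\<Phi> \<omega>)"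
    and [measurable]: "k \<in> borel_measurable borel"
  shows "(\<Sum>n. \<integral>\<^sup>+\<omega>. k (X n \<omega>) * indicator {\<omega>. enat n < N \<omega>} \<omega> \<partial>M) = (\<integral>\<^sup>+x. k x \<partial>\<Lambda>)"
proof -
  interpret prob_space M by fact
  interpret C: sigma_finite_measure "count_space (UNIV :: nat set)"
    by (rule sigma_finite_measure_count_space)
  let ?P = "count_space (UNIV :: nat set) \<Otimes>\<^sub>M M"
  have [measurable]: "(\<lambda>(n, \<omega>). X n \<omega>) \<in> ?P \<rightarrow>\<^sub>M borel"
    by (rule measurable_pair_measure_countable1) auto
  have [measurable]: "(\<lambda>(n, \<omega>). indicator {\<omega>. enat n < N \<omega>} \<omega> :: ennreal) \<in> borel_measurable ?P"
    by (rule measurable_pair_measure_countable1) auto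
  \<comment> \<open>Pairs of an index and an outcome are weighted by whether the index is in use and
    then mapped to the point, so \<open>\<mu>\<close> of a set is the expected number of points in
    it.\<close>
  define \<mu> where "\<mu> = distr (density ?P (\<lambda>(n, \<omega>). indicator {\<omega>. enat n < N \<omega>} \<omega>)) borel (\<lambda>(n, \<omega>). X n \<omega>)"
  have nn_\<mu>: "(\<integral>\<^sup>+x. p x \<partial>\<mu>) = (\<Sum>n. \<integral>\<^sup>+\<omega>. p (X n \<omega>) * indicator {\<omega>. enat n < N \<omega>} \<omega> \<partial>M)"
    if [measurable]: "p \<in> borel_measurable borel" for p
  proof -
    have "(\<integral>\<^sup>+x. p x \<partial>\<mu>) = (\<integral>\<^sup>+z. (case z of (n, \<omega>) \<Rightarrow> indicator {\<omega>. enat n < N \<omega>} \<omega>) * p (case z of (n, \<omega>) \<Rightarrow> X n \<omega>) \<partial>?P)"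
      unfolding \<mu>_def by (simp add: nn_integral_distr nn_integral_density)
    also have "\<dots> = (\<integral>\<^sup>+n. \<integral>\<^sup>+\<omega>. p (X n \<omega>) * indicator {\<omega>. enat n < N \<omega>} \<omega> \<partial>M \<partial>count_space UNIV)"
      by (subst nn_integral_fst[symmetric]) (simp_all add: mult.commute)
    finally show ?thesis by (simp add: nn_integral_count_space_nat)
  qed
  have sets_\<Lambda>: "sets \<Lambda> = sets borel"
    using ppp by (simp add: poisson_point_process_def)
  have eq: "emeasure \<mu> B = emeasure \<Lambda> B" if [measurable]: "B \<in> sets borel" and B: "bounded B" for B
  proof -
    have "emeasure \<mu> B = (\<integral>\<^sup>+x. indicator B x \<partial>\<mu>)"
      by (simp add: \<mu>_def)
    also have "\<dots> = (\<integral>\<^sup>+\<omega>. (\<Sum>n. indicator B (X n \<omega>) * indicator {\<omega>. enat n < N \<omega>} \<omega>) \<partial>M)"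
      by (subst nn_\<mu>) (auto simp: nn_integral_suminf)
    also have "\<dots> = (\<integral>\<^sup>+\<omega>. of_nat (card (\<Phi> \<omega> \<inter> B)) \<partial>M)"
    proof (rule nn_integral_cong)
      fix \<omega> assume \<omega>: "\<omega> \<in> space M"
      let ?J = "{n. enat n < N \<omega> \<and> X n \<omega> \<in> B}"
      have inj: "inj_on (\<lambda>n. X n \<omega>) ?J"
        using bij[OF \<omega>] by (auto simp: bij_betw_def intro: inj_on_subset)
      have img: "(\<lambda>n. X n \<omega>) ` ?J = \<Phi> \<omega> \<inter> B"
        using bij_betw_imp_surj_on[OF bij[OF \<omega>]] by auto
      \<comment> \<open>Local finiteness enters here: on an infinite set \<open>card\<close> would
        be 0 while the series would be infinite.\<close>
      have "finite (\<Phi> \<omega> \<inter> B)"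
        using ppp \<omega> B by (auto simp: poisson_point_process_def)
      then have fin: "finite ?J"
        using inj img finite_imageD by metis
      have "(\<Sum>n. indicator B (X n \<omega>) * indicator {\<omega>. enat n < N \<omega>} \<omega> :: ennreal)
          = (\<Sum>n\<in>?J. indicator B (X n \<omega>) * indicator {\<omega>. enat n < N \<omega>} \<omega>)"
        using fin by (intro suminf_finite) (auto split: split_indicator)
      also have "\<dots> = of_nat (card ?J)"
        by simp
      also have "card ?J = card (\<Phi> \<omega> \<inter> B)"
        using card_image[OF inj] img by simp
      finally show "(\<Sum>n. indicator B (X n \<omega>) * indicator {\<omega>. enat n < N \<omega>} \<omega>)
          = (of_nat (card (\<Phi> \<omega> \<inter> B)) :: ennreal)" .
    qed
    also have "\<dots> = emeasure \<Lambda> B"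
      using assms(1) ppp that by (rule poisson_point_process_mean)
    finally show ?thesis .
  qed
  have "\<mu> = \<Lambda>"
  proof (rule measure_eqI_generator_eq)
    let ?E = "range (\<lambda>(a, b). box a b :: 'a set)"
    show "Int_stable ?E"
      by (auto simp: Int_stable_def box_Int_box)
    show "sets \<mu> = sigma_sets UNIV ?E" "sets \<Lambda> = sigma_sets UNIV ?E"
      by (simp_all add: \<mu>_def sets_\<Lambda> borel_eq_box)
    show "emeasure \<mu> B = emeasure \<Lambda> B" if "B \<in> ?E" for B
      using that by (auto intro!: eq)
    show "range (\<lambda>n. box (- (real n *\<^sub>R One)) (real n *\<^sub>R One)) \<subseteq> ?E"
      by auto
    show "(\<Union>n. box (- (real n *\<^sub>R One)) (real n *\<^sub>R One)) = (UNIV :: 'a set)"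
      by (rule UN_box_eq_UNIV)
    show "emeasure \<mu> (box (- (real n *\<^sub>R One)) (real n *\<^sub>R One)) \<noteq> \<infinity>" for n
      using ppp by (subst eq) (auto simp: poisson_point_process_def less_top)
  qed simp
  with nn_\<mu>[of k] show ?thesis by simp
qed

text \<open>Along the enumeration the interference is a series of products of a function of the
  points and a mark. Independence factors each expectation, the mark contributes its mean 1, and
  Campbell's formula evaluates what remains.\<close>

lemma interference_mean:
  fixes \<Phi> :: "'w \<Rightarrow> (real^2) set"
  assumes "prob_space M" and ppp: "poisson_point_process M \<Phi> \<Lambda>" and marks: "iid_marks M \<Phi> g Q"
    and Q: "AE t in Q. 0 \<le> t" "has_bochner_integral Q (\<lambda>t. t) 1"
    and l: "l \<in> borel_measurable borel" "\<And>r. 0 \<le> r \<Longrightarrow> 0 \<le> l r"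
  shows "interference \<Phi> g l y \<in> borel_measurable M"
    and "(\<integral>\<^sup>+\<omega>. interference \<Phi> g l y \<omega> \<partial>M) = (\<integral>\<^sup>+x. ennreal (l (norm (x - y))) \<partial>\<Lambda>)"
proof -
  interpret prob_space M by fact
  note [measurable] = l(1)
  obtain N :: "'w \<Rightarrow> enat" and X :: "nat \<Rightarrow> 'w \<Rightarrow> real^2" and G :: "nat \<Rightarrow> 'w \<Rightarrow> real" where
    N[measurable]: "N \<in> M \<rightarrow>\<^sub>M count_space UNIV" and X[measurable]: "\<And>n. X n \<in> M \<rightarrow>\<^sub>M borel"
    and bij: "\<And>\<omega>. \<omega> \<in> space M \<Longrightarrow> bij_betw (\<lambda>n. X n \<omega>) {n. enat n < N \<omega>} (\<Phi> \<omega>)"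
    and g: "\<And>\<omega> n. \<omega> \<in> space M \<Longrightarrow> enat n < N \<omega> \<Longrightarrow> g \<omega> (X n \<omega>) = G n \<omega>"
    and G: "indep_vars (\<lambda>_. borel) G UNIV" and distr: "\<And>n. distr M borel (G n) = Q"
    and indep: "indep_set
          (sets (vimage_algebra (space M) (\<lambda>\<omega>. (N \<omega>, \<lambda>n. X n \<omega>))
                   (count_space UNIV \<Otimes>\<^sub>M (\<Pi>\<^sub>M n\<in>UNIV. borel))))
          (sets (vimage_algebra (space M) (\<lambda>\<omega> n. G n \<omega>) (\<Pi>\<^sub>M n\<in>UNIV. borel)))"
    using marks unfolding iid_marks_def by blast
  have G_meas[measurable]: "G n \<in> M \<rightarrow>\<^sub>M borel" for n
    using G by (simp add: indep_vars_def2)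
  have interference_eq: "interference \<Phi> g l y \<omega>
      = (\<Sum>n. (ennreal (l (norm (X n \<omega> - y))) * indicator {\<omega>. enat n < N \<omega>} \<omega>) * ennreal (G n \<omega>))"
    if \<omega>: "\<omega> \<in> space M" for \<omega>
  proof -
    have "interference \<Phi> g l y \<omega>
        = infsum (\<lambda>n. ennreal (g \<omega> (X n \<omega>) * l (norm (X n \<omega> - y)))) {n. enat n < N \<omega>}"
      unfolding interference_def by (rule infsum_reindex_bij_betw[OF bij[OF \<omega>], symmetric])
    \<comment> \<open>The product splits because the path loss is nonnegative; a negative mark,
      possible on a null set, makes both sides 0.\<close>
    also have "\<dots> = infsum (\<lambda>n. ennreal (l (norm (X n \<omega> - y))) * ennreal (G n \<omega>)) {n. enat n < N \<omega>}"
      using g[OF \<omega>] by (intro infsum_cong) (simp add: ennreal_mult'' l mult.commute)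
    finally show ?thesis
      by (simp add: infsum_eq_suminf_indicator indicator_def mult_ac)
  qed
  show "interference \<Phi> g l y \<in> borel_measurable M"
    by (subst measurable_cong[OF interference_eq]) measurable
  have mean: "(\<integral>\<^sup>+\<omega>. ennreal (G n \<omega>) \<partial>M) = 1" for n
  proof -
    have "(\<integral>\<^sup>+\<omega>. ennreal (G n \<omega>) \<partial>M) = (\<integral>\<^sup>+t. ennreal t \<partial>Q)"
      by (subst distr[of n, symmetric]) (simp add: nn_integral_distr)
    also have "\<dots> = 1"
      using Q by (subst nn_integral_eq_integral) (auto simp: has_bochner_integral_iff)
    finally show ?thesis .
  qed
  have "(\<integral>\<^sup>+\<omega>. interference \<Phi> g l y \<omega> \<partial>M)
      = (\<Sum>n. \<integral>\<^sup>+\<omega>. (ennreal (l (norm (X n \<omega> - y))) * indicator {\<omega>. enat n < N \<omega>} \<omega>) * ennreal (G n \<omega>) \<partial>M)"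
    by (subst nn_integral_cong[OF interference_eq]) (simp_all add: nn_integral_suminf)
  also have "\<dots> = (\<Sum>n. \<integral>\<^sup>+\<omega>. ennreal (l (norm (X n \<omega> - y))) * indicator {\<omega>. enat n < N \<omega>} \<omega> \<partial>M)"
  proof (rule suminf_cong)
    fix n
    let ?S = "count_space UNIV \<Otimes>\<^sub>M (\<Pi>\<^sub>M n\<in>UNIV. borel) :: (enat \<times> (nat \<Rightarrow> real^2)) measure"
    let ?T = "(\<Pi>\<^sub>M n\<in>UNIV. borel) :: (nat \<Rightarrow> real) measure"
    \<comment> \<open>Independence is stated for the whole sequences, so each factor is written as a
      function of \<open>N\<close> with all points, or of all marks, that reads only coordinate
      \<open>n\<close>.\<close>
    have "(\<integral>\<^sup>+\<omega>. (\<lambda>(m, x). ennreal (l (norm (x n - y))) * indicator {m. enat n < m} m) (N \<omega>, \<lambda>n. X n \<omega>)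
              * (\<lambda>t. ennreal (t n)) (\<lambda>n. G n \<omega>) \<partial>M)
        = (\<integral>\<^sup>+\<omega>. (\<lambda>(m, x). ennreal (l (norm (x n - y))) * indicator {m. enat n < m} m) (N \<omega>, \<lambda>n. X n \<omega>) \<partial>M)
            * (\<integral>\<^sup>+\<omega>. (\<lambda>t. ennreal (t n)) (\<lambda>n. G n \<omega>) \<partial>M)"
    proof (rule nn_integral_mult_indep_set[OF indep])
      show "(\<lambda>\<omega>. (N \<omega>, \<lambda>n. X n \<omega>)) \<in> M \<rightarrow>\<^sub>M ?S"
        by (intro measurable_Pair N measurable_PiM_single') (auto simp: X)
      show "(\<lambda>\<omega> n. G n \<omega>) \<in> M \<rightarrow>\<^sub>M ?T"
        by (intro measurable_PiM_single') (auto simp: G_meas)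
      show "(\<lambda>t. ennreal (t n)) \<in> borel_measurable ?T"
        by measurable
      show "(\<lambda>(m, x). ennreal (l (norm (x n - y))) * indicator {m. enat n < m} m) \<in> borel_measurable ?S"
        by measurable
    qed
    then show "(\<integral>\<^sup>+\<omega>. (ennreal (l (norm (X n \<omega> - y))) * indicator {\<omega>. enat n < N \<omega>} \<omega>) * ennreal (G n \<omega>) \<partial>M)
        = (\<integral>\<^sup>+\<omega>. ennreal (l (norm (X n \<omega> - y))) * indicator {\<omega>. enat n < N \<omega>} \<omega> \<partial>M)"
      by (simp add: mean indicator_def)
  qed
  also have "\<dots> = (\<integral>\<^sup>+x. ennreal (l (norm (x - y))) \<partial>\<Lambda>)"
    by (rule poisson_point_process_campbell[OF assms(1) ppp N X bij]) measurable
  finally show "(\<integral>\<^sup>+\<omega>. interference \<Phi> g l y \<omega> \<partial>M) = (\<integral>\<^sup>+x. ennreal (l (norm (x - y))) \<partial>\<Lambda>)" .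
qed

subsection \<open>Radial reduction\<close>

text \<open>The hypotheses place \<open>A\<close> above the amplitude of
  \<open>a * cos t + b * sin t\<close>, so the denominator stays positive and an explicit primitive
  can be evaluated over a full period.\<close>

lemma nn_integral_inverse_sub_cos_sin:
  fixes A a b :: real
  assumes "0 < A" "a\<^sup>2 + b\<^sup>2 < A\<^sup>2"
  shows "(\<integral>\<^sup>+t. ennreal (inverse (A - (a * cos t + b * sin t))) * indicator {0..2*pi} t \<partial>lborel)
           = ennreal (2 * pi / sqrt (A\<^sup>2 - (a\<^sup>2 + b\<^sup>2)))"
proof -
  define S where "S = sqrt (A\<^sup>2 - (a\<^sup>2 + b\<^sup>2))"
  have S: "S > 0" "S\<^sup>2 = A\<^sup>2 - (a\<^sup>2 + b\<^sup>2)"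
    using assms by (auto simp: S_def)
  \<comment> \<open>These satisfy \<open>u' = - v\<close> and \<open>v' = u\<close>, and the sum of
    their squares is constant.\<close>
  define u v where "u = (\<lambda>t. a * cos t + b * sin t)" and "v = (\<lambda>t. a * sin t - b * cos t)"
  \<comment> \<open>A primitive that is smooth on the whole line, unlike the one in \<open>tan (t / 2)\<close>: integrating the
    Poisson kernel \<open>1 + 2 * (\<Sum>n\<ge>1. q\<^sup>n * cos (n * t))\<close> termwise gives
    \<open>t + 2 * arctan (q * sin t / (1 - q * cos t))\<close>.\<close>
  define P where "P = (\<lambda>t. t / S + 2 / S * arctan (v t / (A + S - u t)))"
  have uv: "(u t)\<^sup>2 + (v t)\<^sup>2 = a\<^sup>2 + b\<^sup>2" for t
  proof -
    have "(u t)\<^sup>2 + (v t)\<^sup>2 = (a\<^sup>2 + b\<^sup>2) * ((sin t)\<^sup>2 + (cos t)\<^sup>2)"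
      unfolding u_def v_def by algebra
    then show ?thesis by simp
  qed
  have u_less: "u t < A" for t
  proof -
    have "(u t)\<^sup>2 < A\<^sup>2"
      using uv[of t] assms(2) zero_le_power2[of "v t"] by linarith
    then show ?thesis using assms(1) by (simp add: power2_less_imp_less)
  qed
  have deriv: "(P has_real_derivative inverse (A - u t)) (at t)" for t
  proof -
    let ?D = "A + S - u t"
    have D: "?D > 0" "A - u t > 0" using u_less[of t] S by auto
    have "((\<lambda>t. A + S - u t) has_real_derivative v t) (at t)" "(v has_real_derivative u t) (at t)"
      unfolding u_def v_def by (auto intro!: derivative_eq_intros)
    then have "((\<lambda>t. v t / (A + S - u t)) has_real_derivative
        (u t * ?D - v t * v t) / (?D * ?D)) (at t)"
      using D(1) by (intro DERIV_divide) auto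
    note DERIV_chain2[OF DERIV_arctan this]
    then have "(P has_real_derivative
        1 / S + 2 / S * (inverse (1 + (v t / ?D)\<^sup>2) * ((u t * ?D - v t * v t) / (?D * ?D)))) (at t)"
      unfolding P_def by (intro DERIV_add DERIV_cmult DERIV_cdivide DERIV_ident)
    also have "inverse (1 + (v t / ?D)\<^sup>2) * ((u t * ?D - v t * v t) / (?D * ?D))
        = (u t * ?D - v t * v t) / (?D * ?D) / (1 + (v t / ?D)\<^sup>2)"
      by (simp only: divide_inverse mult.commute)
    also have "(u t * ?D - v t * v t) / (?D * ?D) / (1 + (v t / ?D)\<^sup>2)
        = (u t * ?D - (v t)\<^sup>2) / (?D\<^sup>2 + (v t)\<^sup>2)"
    proof -
      have "1 + (v t / ?D)\<^sup>2 = (?D\<^sup>2 + (v t)\<^sup>2) / (?D * ?D)"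
        using D(1) by (simp add: power_divide power2_eq_square add_divide_distrib)
      then show ?thesis using D(1) by (simp add: power2_eq_square)
    qed
    also have "1 / S + 2 / S * ((u t * ?D - (v t)\<^sup>2) / (?D\<^sup>2 + (v t)\<^sup>2)) = inverse (A - u t)"
    proof -
      define q w where "q = ?D\<^sup>2 + (v t)\<^sup>2" and "w = u t * ?D - (v t)\<^sup>2"
      have q: "q > 0" using D by (simp add: q_def add_pos_nonneg)
      \<comment> \<open>Since \<open>u^2 + v^2 = A^2 - S^2\<close>, one has
        \<open>q = 2 (A + S) (A - u)\<close> and \<open>q + 2 w = 2 S (A + S)\<close>.\<close>
      have "(q + 2 * w) * (A - u t) = S * q"
        using uv[of t] S(2) unfolding q_def w_def by algebra
      then have "(q + 2 * w) / (S * q) = inverse (A - u t)"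
        using q S(1) D(2) by (simp add: divide_eq_eq field_simps)
      moreover have "1 / S + 2 / S * (w / q) = (q + 2 * w) / (S * q)"
        using q S(1) by (simp add: field_simps)
      ultimately show ?thesis by (simp only: q_def w_def)
    qed
    finally show ?thesis .
  qed
  have "(\<integral>\<^sup>+t. ennreal (inverse (A - u t)) * indicator {0..2*pi} t \<partial>lborel) = P (2*pi) - P 0"
  proof (rule nn_integral_FTC_Icc)
    show "(\<lambda>t. inverse (A - u t)) \<in> borel_measurable borel"
      unfolding u_def by measurable
  qed (use u_less in \<open>auto simp: deriv less_imp_le\<close>)
  \<comment> \<open>The arctangent term is periodic, so only the linear term of \<open>P\<close>
    contributes.\<close>
  also have "P (2*pi) - P 0 = 2 * pi / S"
    by (simp add: P_def u_def v_def)
  finally show ?thesis by (simp add: u_def S_def)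
qed

section \<open>Rotation invariance and radial projection of Lebesgue measure\<close>

text \<open>Boxes determine \<open>lborel\<close>, and the preimage of a box is its image under the
  inverse \<open>T'\<close>, which is again orthogonal and preserves measure.\<close>

lemma distr_lborel_orthogonal_transformation:
  fixes T :: "real^'n::{finite,wellorder} \<Rightarrow> real^'n::_"
  assumes "orthogonal_transformation T"
  shows "distr lborel borel T = lborel"
proof (rule lborel_eqI[symmetric])
  have [measurable]: "T \<in> borel_measurable borel"
    using assms by (intro borel_measurable_continuous_onI linear_continuous_on linear_conv_bounded_linear[THEN iffD1])
       (simp add: orthogonal_transformation_linear)
  fix l u :: "real^'n::_" assume le: "\<And>b. b \<in> Basis \<Longrightarrow> l \<bullet> b \<le> u \<bullet> b"
  obtain T' where T': "orthogonal_transformation T'" "T' \<circ> T = id" "T \<circ> T' = id"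
    using assms orthogonal_transformation_inv orthogonal_transformation_bij
    by (metis bij_is_inj bij_is_surj inv_o_cancel surj_iff)
  have vim: "T -` box l u = T' ` box l u"
    using T'(2,3) by (auto simp: fun_eq_iff image_iff) metis
  have "T' ` box l u \<in> lmeasurable" "measure lebesgue (T' ` box l u) = measure lebesgue (box l u)"
    using measurable_orthogonal_image[OF T'(1)] measure_orthogonal_image[OF T'(1)] by auto
  then have "emeasure lebesgue (T -` box l u) = emeasure lebesgue (box l u)"
    unfolding vim by (metis emeasure_eq_measure2 lmeasurable_box)
  moreover have "T -` box l u \<in> sets borel"
    using measurable_sets[of T borel borel "box l u"] by simp
  ultimately have "emeasure lborel (T -` box l u) = emeasure lborel (box l u)"
    by simp
  then show "emeasure (distr lborel borel T) (box l u) = (\<Prod>b\<in>Basis. (u - l) \<bullet> b)"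
    using le by (simp add: emeasure_distr)
qed simp

text \<open>This is polar integration of radial functions: both measures give \<open>{..a}\<close>
  the area of a disc, with \<open>max 0 a\<close> covering the empty disc.\<close>

lemma distr_lborel_norm_plane:
  "distr lborel borel (norm :: real^2 \<Rightarrow> real)
     = density lborel (\<lambda>r. ennreal (2 * pi * r) * indicator {0..} r)"
proof (rule measure_eqI_generator_eq)
  let ?E = "range (\<lambda>a::real. {..a})"
  show "Int_stable ?E"
    by (auto simp: Int_stable_def)
  show "sets (distr lborel borel (norm :: real^2 \<Rightarrow> real)) = sigma_sets UNIV ?E"
    "sets (density lborel (\<lambda>r. ennreal (2 * pi * r) * indicator {0..} r)) = sigma_sets UNIV ?E"
    by (simp_all add: borel_eq_atMost)
  have L: "emeasure (distr lborel borel (norm :: real^2 \<Rightarrow> real)) {..a} = ennreal (pi * (max 0 a)\<^sup>2)" for a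
  proof -
    have "norm -` {..a} = (if a \<ge> 0 then cball (0 :: real^2) a else {})"
      by (auto simp: order_trans[OF norm_ge_zero])
    then show ?thesis
      by (auto simp: emeasure_distr emeasure_cball unit_ball_vol_2)
  qed
  have R: "emeasure (density lborel (\<lambda>r. ennreal (2 * pi * r) * indicator {0..} r)) {..a}
      = ennreal (pi * (max 0 a)\<^sup>2)" for a
  proof -
    have "emeasure (density lborel (\<lambda>r. ennreal (2 * pi * r) * indicator {0..} r)) {..a}
        = (\<integral>\<^sup>+r. ennreal (2 * pi * r) * indicator {0..max 0 a} r \<partial>lborel)"
      by (subst emeasure_density) (auto intro!: nn_integral_cong split: split_indicator)
    also have "\<dots> = ennreal (pi * (max 0 a)\<^sup>2 - pi * 0\<^sup>2)"
      by (rule nn_integral_FTC_Icc) (auto intro!: derivative_eq_intros)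
    finally show ?thesis by simp
  qed
  show "emeasure (distr lborel borel (norm :: real^2 \<Rightarrow> real)) X
     = emeasure (density lborel (\<lambda>r. ennreal (2 * pi * r) * indicator {0..} r)) X" if "X \<in> ?E" for X
    using that by (auto simp: L R)
  show "(\<Union>i. {..real i}) = UNIV"
    by (auto simp: real_arch_simple)
  show "emeasure (distr lborel borel (norm :: real^2 \<Rightarrow> real)) {..real i} \<noteq> \<infinity>" for i
    by (simp add: L)
qed auto

text \<open>The sum form matches the derivative of \<open>arsinh\<close>; the product form shows
  positivity and yields lower bounds.\<close>

lemma radial_discriminant:
  fixes c r R :: real
  shows "(c + r\<^sup>2 + R\<^sup>2)\<^sup>2 - 4 * r\<^sup>2 * R\<^sup>2 = (r\<^sup>2 + c - R\<^sup>2)\<^sup>2 + 4 * R\<^sup>2 * c"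
    and "(c + r\<^sup>2 + R\<^sup>2)\<^sup>2 - 4 * r\<^sup>2 * R\<^sup>2 = (c + (r - R)\<^sup>2) * (c + (r + R)\<^sup>2)"
  by algebra+

section \<open>Plane rotations and averages over circles\<close>

definition rot90 :: "real^2 \<Rightarrow> real^2" where
  "rot90 x = vector [- (x $ 2), x $ 1]"

lemma linear_rot90: "linear rot90"
  by (rule linearI) (simp_all add: rot90_def vec_eq_iff forall_2)

lemma inner_rot90 [simp]: "rot90 x \<bullet> x = 0" "x \<bullet> rot90 x = 0" "rot90 x \<bullet> rot90 x = x \<bullet> x"
  by (simp_all add: rot90_def inner_vec_def sum_2)

text \<open>Pythagoras for \<open>y\<close> in the orthogonal frame \<open>x\<close>,
  \<open>rot90 x\<close>, whose vectors have equal length.\<close>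

lemma inner_rot90_sum_squares: "(x \<bullet> y)\<^sup>2 + (rot90 x \<bullet> y)\<^sup>2 = (norm x)\<^sup>2 * (norm y)\<^sup>2"
  unfolding power2_norm_eq_inner by (simp add: rot90_def inner_vec_def sum_2) algebra

definition rotation :: "real \<Rightarrow> real^2 \<Rightarrow> real^2" where
  "rotation t x = cos t *\<^sub>R x + sin t *\<^sub>R rot90 x"

lemma norm_rotation [simp]: "norm (rotation t x) = norm x"
proof -
  have "rotation t x \<bullet> rotation t x = ((sin t)\<^sup>2 + (cos t)\<^sup>2) * (x \<bullet> x)"
    by (simp add: rotation_def inner_add_left inner_add_right power2_eq_square algebra_simps
        del: sin_cos_squared_add sin_cos_squared_add2 sin_cos_squared_add3)
  then show ?thesis by (simp add: norm_eq_sqrt_inner)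
qed

lemma orthogonal_transformation_rotation: "orthogonal_transformation (rotation t)"
  unfolding orthogonal_transformation
proof
  show "linear (rotation t)"
    unfolding rotation_def using linear_rot90
    by (intro linear_compose_add linear_compose_scale_right) (auto simp: linear_iff)
qed simp

text \<open>Joint measurability in angle and point is needed to exchange the two integrals in
  \<open>nn_integral_radial_kernel\<close>.\<close>

lemma measurable_rotation [measurable]:
  assumes [measurable]: "s \<in> borel_measurable M" "f \<in> borel_measurable M"
  shows "(\<lambda>z. rotation (s z) (f z)) \<in> borel_measurable M"
proof -
  have [measurable]: "rot90 \<in> borel_measurable borel"
    using linear_rot90 by (intro borel_measurable_continuous_onI linear_continuous_on) (simp add: linear_conv_bounded_linear)
  show ?thesis
    unfolding rotation_def by measurable
qed

text \<open>Expanding the squared distance gives \<open>A - (a * cos t + b * sin t)\<close> with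
  amplitude \<open>2 * norm x * norm y\<close>. The integral is not divided by
  \<open>2 * pi\<close>, and its value depends on \<open>x\<close> only through
  \<open>norm x\<close>.\<close>

lemma circle_average_inverse_dist:
  fixes x y :: "real^2"
  assumes "0 < c"
  shows "(\<integral>\<^sup>+t. ennreal (inverse (c + (norm (rotation t x - y))\<^sup>2)) * indicator {0..2*pi} t \<partial>lborel)
    = ennreal (2 * pi / sqrt ((c + (norm x)\<^sup>2 + (norm y)\<^sup>2)\<^sup>2 - 4 * (norm x)\<^sup>2 * (norm y)\<^sup>2))"
proof -
  define A a b where "A = c + (norm x)\<^sup>2 + (norm y)\<^sup>2" and "a = 2 * (x \<bullet> y)" and "b = 2 * (rot90 x \<bullet> y)"
  have ab: "a\<^sup>2 + b\<^sup>2 = 4 * (norm x)\<^sup>2 * (norm y)\<^sup>2"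
    using inner_rot90_sum_squares[of x y] by (simp add: a_def b_def power_mult_distrib)
  have expand: "c + (norm (rotation t x - y))\<^sup>2 = A - (a * cos t + b * sin t)" for t
  proof -
    have "(norm (rotation t x - y))\<^sup>2 = (norm x)\<^sup>2 + (norm y)\<^sup>2 - 2 * (rotation t x \<bullet> y)"
      using dot_norm_neg[of "rotation t x" y] by simp
    then show ?thesis
      by (simp add: A_def a_def b_def rotation_def inner_add_left algebra_simps)
  qed
  have "0 < A" "a\<^sup>2 + b\<^sup>2 < A\<^sup>2"
  proof -
    have "(c + (norm x)\<^sup>2 + (norm y)\<^sup>2)\<^sup>2 - 4 * (norm x)\<^sup>2 * (norm y)\<^sup>2 > 0"
      unfolding radial_discriminant(2) using assms by (intro mult_pos_pos add_pos_nonneg) auto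
    then show "a\<^sup>2 + b\<^sup>2 < A\<^sup>2" by (simp add: ab A_def)
    show "0 < A" using assms by (simp add: A_def add_pos_nonneg)
  qed
  then show ?thesis
    unfolding expand by (simp only: nn_integral_inverse_sub_cos_sin ab A_def)
qed

text \<open>Rotating the kernel leaves the integral unchanged, so it may be integrated over all
  angles. After the exchange of integrals the inner one is a radial function, and pushing forward
  under \<open>norm\<close> leaves a one-dimensional integral.\<close>

lemma nn_integral_radial_kernel:
  fixes y :: "real^2" and \<phi> :: "real \<Rightarrow> ennreal"
  assumes [measurable]: "\<phi> \<in> borel_measurable borel" and c: "0 < c"
  shows "(\<integral>\<^sup>+x. \<phi> (norm x) * ennreal (inverse (c + (norm (x - y))\<^sup>2)) \<partial>lborel)
    = ennreal pi * (\<integral>\<^sup>+r. \<phi> r * ennreal (2 * r / sqrt ((c + r\<^sup>2 + (norm y)\<^sup>2)\<^sup>2 - 4 * r\<^sup>2 * (norm y)\<^sup>2))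
        * indicator {0..} r \<partial>lborel)"
proof -
  define s where "s r = sqrt ((c + r\<^sup>2 + (norm y)\<^sup>2)\<^sup>2 - 4 * r\<^sup>2 * (norm y)\<^sup>2)" for r
  have [measurable]: "s \<in> borel_measurable borel"
    unfolding s_def by measurable
  have s_nonneg: "0 \<le> s r" for r
    unfolding s_def radial_discriminant(2) using c by auto
  let ?k = "\<lambda>x. ennreal (inverse (c + (norm (x - y))\<^sup>2))"
  define I where "I = (\<integral>\<^sup>+x. \<phi> (norm x) * ?k x \<partial>lborel)"
  have rot: "I = (\<integral>\<^sup>+x. \<phi> (norm x) * ?k (rotation t x) \<partial>lborel)" for t
    unfolding I_def
    by (subst distr_lborel_orthogonal_transformation[OF orthogonal_transformation_rotation[of t], symmetric])
       (simp add: nn_integral_distr)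
  have "ennreal (2 * pi) * I = (\<integral>\<^sup>+t. I * indicator {0..2*pi} t \<partial>lborel)"
    by (simp add: nn_integral_cmult_indicator mult.commute)
  also have "\<dots> = (\<integral>\<^sup>+t. \<integral>\<^sup>+x. \<phi> (norm x) * (?k (rotation t x) * indicator {0..2*pi} t) \<partial>lborel \<partial>lborel)"
  proof (rule nn_integral_cong)
    fix t :: real
    show "I * indicator {0..2*pi} t
        = (\<integral>\<^sup>+x. \<phi> (norm x) * (?k (rotation t x) * indicator {0..2*pi} t) \<partial>lborel)"
      unfolding rot[of t] by (simp add: nn_integral_multc[symmetric] mult.assoc)
  qed
  also have "\<dots> = (\<integral>\<^sup>+x. \<integral>\<^sup>+t. \<phi> (norm x) * (?k (rotation t x) * indicator {0..2*pi} t) \<partial>lborel \<partial>lborel)"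
    by (rule lborel_pair.Fubini') measurable
  also have "\<dots> = (\<integral>\<^sup>+x. \<phi> (norm (x :: real^2)) * ennreal (2 * pi / s (norm x)) \<partial>lborel)"
    using circle_average_inverse_dist[OF c, of _ y]
    by (simp add: nn_integral_cmult s_def)
  also have "\<dots> = (\<integral>\<^sup>+r. \<phi> r * ennreal (2 * pi / s r) \<partial>distr lborel borel (norm :: real^2 \<Rightarrow> real))"
    by (simp add: nn_integral_distr)
  also have "\<dots> = (\<integral>\<^sup>+r. (ennreal (2 * pi * r) * indicator {0..} r) * (\<phi> r * ennreal (2 * pi / s r)) \<partial>lborel)"
    unfolding distr_lborel_norm_plane by (subst nn_integral_density) auto
  \<comment> \<open>One factor \<open>2 * pi\<close> is split off to cancel the length of the angle
    interval; the rest is grouped so that \<open>2 * r / s r\<close>, the derivative of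
    \<open>arsinh_radial\<close>, appears.\<close>
  also have "\<dots> = (\<integral>\<^sup>+r. ennreal (2 * pi) * (ennreal pi * (\<phi> r * ennreal (2 * r / s r) * indicator {0..} r)) \<partial>lborel)"
  proof (rule nn_integral_cong)
    fix r :: real
    have "ennreal (2 * pi * r) * ennreal (2 * pi / s r) = ennreal (2 * pi) * (ennreal pi * ennreal (2 * r / s r))"
      if "0 \<le> r" using that s_nonneg[of r] by (simp add: ennreal_mult'[symmetric] field_simps)
    then show "(ennreal (2 * pi * r) * indicator {0..} r) * (\<phi> r * ennreal (2 * pi / s r))
        = ennreal (2 * pi) * (ennreal pi * (\<phi> r * ennreal (2 * r / s r) * indicator {0..} r))"
      by (auto simp: mult_ac split: split_indicator)
  qed
  also have "\<dots> = ennreal (2 * pi) * (ennreal pi * (\<integral>\<^sup>+r. \<phi> r * ennreal (2 * r / s r) * indicator {0..} r \<partial>lborel))"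
    by (simp add: nn_integral_cmult)
  finally have "I = ennreal pi * (\<integral>\<^sup>+r. \<phi> r * ennreal (2 * r / s r) * indicator {0..} r \<partial>lborel)"
    using pi_gt_zero by (auto simp: ennreal_mult_cancel_left ennreal_eq_0_iff)
  then show ?thesis
    unfolding I_def s_def .
qed

subsection \<open>The radial integral\<close>

text \<open>Over a large box the extended integrand integrates to \<open>G y - G a\<close>, where
  \<open>y\<close> is the right endpoint. This covers conditionally convergent integrals as
  well.\<close>

lemma has_integral_deriv_atLeast:
  fixes G G' :: "real \<Rightarrow> real"
  assumes deriv: "\<And>x. a \<le> x \<Longrightarrow> (G has_real_derivative G' x) (at x within {a..})"
    and lim: "(G \<longlongrightarrow> l) at_top"
  shows "(G' has_integral l - G a) {a..}"
proof -
  have FTC: "(G' has_integral G y - G a) {a..y}" if "a \<le> y" for y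
    using that by (intro fundamental_theorem_of_calculus)
      (auto simp flip: has_real_derivative_iff_has_vector_derivative intro!: DERIV_subset[OF deriv])
  have restr: "((\<lambda>t. if t \<in> {a..} then G' t else 0) has_integral G y - G a) (cbox x y)"
    if "x \<le> a" "a \<le> y" for x y
  proof -
    have "((\<lambda>t. if t \<in> {a..y} then G' t else 0) has_integral G y - G a) (cbox x y)"
      using that FTC[of y] by (subst has_integral_restrict) auto
    then show ?thesis
      by (rule has_integral_eq[rotated]) (use that in auto)
  qed
  show ?thesis
    unfolding has_integral'[where S = "{a..}"]
  proof (intro allI impI)
    fix e :: real assume "e > 0"
    then obtain B where B: "\<And>y. B \<le> y \<Longrightarrow> \<bar>G y - l\<bar> < e"
      using lim by (auto simp: tendsto_iff eventually_at_top_linorder dist_real_def)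
    \<comment> \<open>A box containing the open ball of radius \<open>C + 1\<close> contains
      \<open>- C\<close> and \<open>C\<close>, hence starts left of \<open>a\<close> and ends beyond
      \<open>B\<close>.\<close>
    define C where "C = max 1 (max \<bar>a\<bar> B)"
    have "\<exists>z. ((\<lambda>t. if t \<in> {a..} then G' t else 0) has_integral z) (cbox x y) \<and> norm (z - (l - G a)) < e"
      if "ball 0 (C + 1) \<subseteq> cbox x y" for x y
    proof -
      have "- C \<in> ball 0 (C + 1)" "C \<in> ball 0 (C + 1)" by (auto simp: C_def)
      then have "- C \<in> cbox x y" "C \<in> cbox x y" using that by blast+
      moreover have "\<bar>a\<bar> \<le> C" "B \<le> C" by (auto simp: C_def)
      ultimately have "x \<le> a" "a \<le> y" "B \<le> y" by auto
      then show ?thesis using restr B[of y] by (intro exI[of _ "G y - G a"]) auto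
    qed
    then show "\<exists>C>0. \<forall>x y. ball 0 C \<subseteq> cbox x y \<longrightarrow>
        (\<exists>z. ((\<lambda>t. if t \<in> {a..} then G' t else 0) has_integral z) (cbox x y) \<and> norm (z - (l - G a)) < e)"
      by (intro exI[of _ "C + 1"]) (auto simp: C_def)
  qed
qed

section \<open>Growth and decay of the radial integrand\<close>

lemma decays_like_powerE:
  assumes "decays_like_power F \<nu>"
  obtains K r0 where "0 < K" "0 < r0" "\<And>r. r0 \<le> r \<Longrightarrow> F r \<le> K * r powr - \<nu>"
proof -
  obtain L where L: "L > 0" "((\<lambda>r. F r * r powr \<nu>) \<longlongrightarrow> L) at_top"
    using assms by (auto simp: decays_like_power_def)
  have "eventually (\<lambda>r. F r * r powr \<nu> < L + 1) at_top"
    using L(2) by (rule order_tendstoD) simp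
  then obtain r1 where r1: "\<And>r. r1 \<le> r \<Longrightarrow> F r * r powr \<nu> < L + 1"
    by (auto simp: eventually_at_top_linorder)
  show ?thesis
  proof
    \<comment> \<open>\<open>L + 1\<close> is any bound above the limit; the maximum with 1 keeps
      \<open>r\<close> positive, so that \<open>r powr \<nu>\<close> can be divided out.\<close>
    show "0 < L + 1" "0 < max 1 r1" using L by auto
    show "F r \<le> (L + 1) * r powr - \<nu>" if "max 1 r1 \<le> r" for r
      using r1[of r] that by (auto simp: powr_minus field_simps)
  qed
qed

definition arsinh_radial :: "real \<Rightarrow> real \<Rightarrow> real \<Rightarrow> real" where
  "arsinh_radial R c r = arsinh ((r\<^sup>2 + c - R\<^sup>2) / (2 * R * sqrt c))"

text \<open>Moving \<open>2 * R * sqrt c\<close> under the root turns \<open>z^2 + 1\<close> into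
  the sum form of the discriminant, so the radial kernel is an exact derivative.\<close>

lemma arsinh_radial_deriv:
  assumes "0 < R" "0 < c"
  shows "(arsinh_radial R c has_real_derivative
           2 * r / sqrt ((c + r\<^sup>2 + R\<^sup>2)\<^sup>2 - 4 * r\<^sup>2 * R\<^sup>2)) (at r within A)"
proof -
  define z where "z = (r\<^sup>2 + c - R\<^sup>2) / (2 * R * sqrt c)"
  have "(arsinh_radial R c has_real_derivative
      (1 / sqrt (z\<^sup>2 + 1)) * (2 * r / (2 * R * sqrt c))) (at r within A)"
    unfolding arsinh_radial_def z_def
    by (rule DERIV_chain2[OF arsinh_real_has_field_derivative]) (use assms in \<open>auto intro!: derivative_eq_intros\<close>)
  also have "(1 / sqrt (z\<^sup>2 + 1)) * (2 * r / (2 * R * sqrt c))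
      = 2 * r / sqrt ((z\<^sup>2 + 1) * (2 * R * sqrt c)\<^sup>2)"
    using assms by (simp add: real_sqrt_mult)
  also have "(z\<^sup>2 + 1) * (2 * R * sqrt c)\<^sup>2 = (r\<^sup>2 + c - R\<^sup>2)\<^sup>2 + (2 * R * sqrt c)\<^sup>2"
    using assms by (simp add: z_def power_divide distrib_right)
  also have "\<dots> = (c + r\<^sup>2 + R\<^sup>2)\<^sup>2 - 4 * r\<^sup>2 * R\<^sup>2"
    using assms by (simp add: radial_discriminant(1) power_mult_distrib)
  finally show ?thesis .
qed

text \<open>For \<open>r\<close> at least \<open>2 * R\<close>, both \<open>r - R\<close> and
  \<open>r + R\<close> are at least \<open>r / 2\<close>, so the root is at least
  \<open>(r / 2)^2\<close>.\<close>

lemma radial_kernel_le: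
  assumes "0 < c" "0 < R" "2 * R \<le> r"
  shows "2 * r / sqrt ((c + r\<^sup>2 + R\<^sup>2)\<^sup>2 - 4 * r\<^sup>2 * R\<^sup>2) \<le> 8 / r"
proof -
  have r: "r > 0" using assms by auto
  have "(r / 2)\<^sup>2 \<le> (r - R)\<^sup>2" "(r / 2)\<^sup>2 \<le> (r + R)\<^sup>2"
    using assms by (intro power_mono; simp)+
  then have "(r / 2)\<^sup>2 \<le> c + (r - R)\<^sup>2" "(r / 2)\<^sup>2 \<le> c + (r + R)\<^sup>2"
    using assms by linarith+
  then have "(r / 2)\<^sup>2 * (r / 2)\<^sup>2 \<le> (c + r\<^sup>2 + R\<^sup>2)\<^sup>2 - 4 * r\<^sup>2 * R\<^sup>2"
    unfolding radial_discriminant(2) by (intro mult_mono) (auto intro: order_trans[rotated])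
  then have "sqrt ((r / 2)\<^sup>2 * (r / 2)\<^sup>2) \<le> sqrt ((c + r\<^sup>2 + R\<^sup>2)\<^sup>2 - 4 * r\<^sup>2 * R\<^sup>2)"
    by (rule real_sqrt_le_mono)
  then have le: "(r / 2)\<^sup>2 \<le> sqrt ((c + r\<^sup>2 + R\<^sup>2)\<^sup>2 - 4 * r\<^sup>2 * R\<^sup>2)"
    by (simp only: real_sqrt_abs2 abs_power2)
  have "2 * r / sqrt ((c + r\<^sup>2 + R\<^sup>2)\<^sup>2 - 4 * r\<^sup>2 * R\<^sup>2) \<le> 2 * r / (r / 2)\<^sup>2"
  proof (rule divide_left_mono)
    have "0 < (r / 2)\<^sup>2" using r by simp
    with le show "0 < sqrt ((c + r\<^sup>2 + R\<^sup>2)\<^sup>2 - 4 * r\<^sup>2 * R\<^sup>2) * (r / 2)\<^sup>2"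
      by (intro mult_pos_pos) linarith+
  qed (use r le in auto)
  also have "\<dots> = 8 / r"
    using r by (simp add: field_simps power2_eq_square)
  finally show ?thesis .
qed

text \<open>The logarithmic growth of \<open>arsinh_radial\<close> loses against
  \<open>r powr - \<nu>\<close>, while \<open>F r * r powr \<nu>\<close> converges.\<close>

lemma tendsto_power_decay_arsinh_radial:
  assumes "\<And>r. 0 \<le> r \<Longrightarrow> 0 \<le> F r" "decays_like_power F \<nu>" "0 < \<nu>" "0 < R" "0 < c"
  shows "((\<lambda>r. F r * arsinh_radial R c r) \<longlongrightarrow> 0) at_top"
proof -
  obtain L where L: "((\<lambda>r. F r * r powr \<nu>) \<longlongrightarrow> L) at_top"
    using assms(2) by (auto simp: decays_like_power_def)
  have "((\<lambda>r. r powr - \<nu> * arsinh_radial R c r) \<longlongrightarrow> 0) at_top"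
    using assms(3-5) unfolding arsinh_radial_def arsinh_real_def by real_asymp
  from tendsto_mult[OF L this] have "((\<lambda>r. (F r * r powr \<nu>) * (r powr - \<nu> * arsinh_radial R c r)) \<longlongrightarrow> 0) at_top"
    by simp
  then show ?thesis
    by (rule Lim_transform_eventually)
      (intro eventually_mono[OF eventually_gt_at_top[of 0]], simp add: powr_minus field_simps)
qed

text \<open>Up to \<open>b\<close> the integrand is continuous on a compact interval; beyond
  \<open>b\<close> it is at most a multiple of \<open>r powr (- \<nu> - 1)\<close>, which is
  integrable since \<nu> is positive.\<close>

lemma radial_integral_finite:
  fixes F k :: "real \<Rightarrow> real"
  assumes cont: "continuous_on {0..} F" "continuous_on {0..} k"
    and nonneg: "\<And>r. 0 \<le> r \<Longrightarrow> 0 \<le> F r" "\<And>r. 0 \<le> r \<Longrightarrow> 0 \<le> k r"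
    and decay: "decays_like_power F \<nu>" "0 < \<nu>"
    and bound: "\<And>r. r1 \<le> r \<Longrightarrow> k r \<le> C / r"
  shows "(\<integral>\<^sup>+r. ennreal (F r * k r) * indicator {0..} r \<partial>lborel) < \<infinity>"
proof -
  obtain K r0 where K: "0 < K" "0 < r0" "\<And>r. r0 \<le> r \<Longrightarrow> F r \<le> K * r powr - \<nu>"
    using decay(1) by (rule decays_like_powerE) blast
  define b where "b = max r0 r1"
  have b: "0 < b" "r0 \<le> b" "r1 \<le> b" using K by (auto simp: b_def)
  have Fk: "continuous_on {0..b} (\<lambda>r. F r * k r)"
    using cont by (intro continuous_intros) (auto intro: continuous_on_subset)
  have "(\<integral>\<^sup>+r. ennreal (F r * k r) * indicator {0..} r \<partial>lborel)
      \<le> (\<integral>\<^sup>+r. ennreal (F r * k r) * indicator {0..b} r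
            + ennreal (K * \<bar>C\<bar> * r powr (- \<nu> - 1)) * indicator {b..} r \<partial>lborel)"
  proof (rule nn_integral_mono)
    fix r :: real
    have "F r * k r \<le> K * \<bar>C\<bar> * r powr (- \<nu> - 1)" if "b \<le> r"
    proof -
      have r: "r > 0" "r0 \<le> r" "r1 \<le> r" using that b by auto
      have "k r \<le> \<bar>C\<bar> / r" using bound[of r] r by (auto elim!: order_trans intro!: divide_right_mono)
      then have "F r * k r \<le> (K * r powr - \<nu>) * (\<bar>C\<bar> / r)"
        using K(3)[of r] r nonneg[of r] K(1) by (intro mult_mono) auto
      also have "\<dots> = K * \<bar>C\<bar> * r powr (- \<nu> - 1)"
        using r by (simp add: powr_diff)
      finally show ?thesis .
    qed
    then show "ennreal (F r * k r) * indicator {0..} r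
        \<le> ennreal (F r * k r) * indicator {0..b} r
            + ennreal (K * \<bar>C\<bar> * r powr (- \<nu> - 1)) * indicator {b..} r"
      using b by (auto split: split_indicator intro!: ennreal_leI)
  qed
  also have "\<dots> = (\<integral>\<^sup>+r. ennreal (F r * k r) * indicator {0..b} r \<partial>lborel)
      + (\<integral>\<^sup>+r. ennreal (K * \<bar>C\<bar> * r powr (- \<nu> - 1)) * indicator {b..} r \<partial>lborel)"
  proof (rule nn_integral_add)
    have "(\<lambda>r. F r * k r * indicator {0..b} r) \<in> borel_measurable borel"
      using borel_measurable_continuous_on_indicator[OF _ Fk] by (simp add: mult.commute)
    then have "(\<lambda>r. ennreal (F r * k r * indicator {0..b} r)) \<in> borel_measurable lborel" by simp
    then show "(\<lambda>r. ennreal (F r * k r) * indicator {0..b} r) \<in> borel_measurable lborel"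
      by (rule measurable_cong[THEN iffD1, rotated]) (auto split: split_indicator)
  qed simp
  also have "\<dots> < \<infinity>"
  proof -
    have "((\<lambda>r. F r * k r) has_integral integral {0..b} (\<lambda>r. F r * k r)) {0..b}"
      using Fk by (intro integrable_integral integrable_continuous_interval)
    then have 1: "(\<integral>\<^sup>+r. ennreal (F r * k r) * indicator {0..b} r \<partial>lborel) < \<infinity>"
      by (subst nn_integral_has_integral_lebesgue'[rotated]) (auto intro!: mult_nonneg_nonneg nonneg)
    have "((\<lambda>r. K * \<bar>C\<bar> * r powr (- \<nu> - 1)) has_integral
        K * \<bar>C\<bar> * (- (b powr (- \<nu> - 1 + 1)) / (- \<nu> - 1 + 1))) {b..}"
      using b decay(2) by (intro has_integral_mult_right has_integral_powr_to_inf) auto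
    then have "(\<integral>\<^sup>+r. ennreal (K * \<bar>C\<bar> * r powr (- \<nu> - 1)) * indicator {b..} r \<partial>lborel) < \<infinity>"
      by (subst nn_integral_has_integral_lebesgue'[rotated]) (use K in auto)
    with 1 show ?thesis by simp
  qed
  finally show ?thesis .
qed

text \<open>The derivative of \<open>F * arsinh_radial R c\<close> has an improper integral because
  the boundary term vanishes at infinity. Subtracting the absolutely convergent \<open>F * k\<close>
  yields both the existence and the value of the integral with \<open>f\<close>.\<close>

lemma radial_integral_by_parts:
  assumes bounds: "\<And>r. 0 \<le> r \<Longrightarrow> 0 \<le> F r"
    and deriv: "\<And>r. 0 \<le> r \<Longrightarrow> (F has_real_derivative f r) (at r within {0..})"
    and decay: "decays_like_power F \<nu>" "0 < \<nu>" and pos: "0 < R" "0 < c"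
  defines "k \<equiv> \<lambda>r. 2 * r / sqrt ((c + r\<^sup>2 + R\<^sup>2)\<^sup>2 - 4 * r\<^sup>2 * R\<^sup>2)"
  shows "(\<lambda>r. f r * arsinh_radial R c r) integrable_on {0..}"
    and "- (F 0 * arsinh_radial R c 0 + integral {0..} (\<lambda>r. f r * arsinh_radial R c r)) \<ge> 0"
    and "(\<integral>\<^sup>+r. ennreal (F r * k r) * indicator {0..} r \<partial>lborel)
      = ennreal (- (F 0 * arsinh_radial R c 0 + integral {0..} (\<lambda>r. f r * arsinh_radial R c r)))"
proof -
  let ?h = "arsinh_radial R c"
  have disc: "(c + r\<^sup>2 + R\<^sup>2)\<^sup>2 - 4 * r\<^sup>2 * R\<^sup>2 > 0" for r
    unfolding radial_discriminant(2) using pos by (intro mult_pos_pos add_pos_nonneg) auto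
  have contF: "continuous_on {0..} F"
    using deriv by (meson DERIV_continuous_on atLeast_iff)
  have contk: "continuous_on {0..} k"
    unfolding k_def using disc by (intro continuous_intros) (auto simp: less_imp_neq[symmetric] simp del: real_sqrt_eq_zero_cancel_iff)
  have k_nonneg: "0 \<le> k r" if "0 \<le> r" for r
    using that disc[of r] by (simp add: k_def)
  have fin: "(\<integral>\<^sup>+r. ennreal (F r * k r) * indicator {0..} r \<partial>lborel) < \<infinity>"
    using contF contk bounds k_nonneg decay
    by (rule radial_integral_finite[where C = 8 and ?r1.0 = "2 * R"]) (auto simp: k_def intro!: radial_kernel_le pos)
  have meas: "(\<lambda>r. indicator {0..} r *\<^sub>R (F r * k r)) \<in> borel_measurable borel"
    using contF contk by (intro borel_measurable_continuous_on_indicator continuous_intros) auto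
  have fin': "(\<integral>\<^sup>+r. ennreal (indicator {0..} r *\<^sub>R (F r * k r)) \<partial>lborel) < \<infinity>"
    using fin by (rule le_less_trans[rotated]) (auto intro!: nn_integral_mono split: split_indicator)
  \<comment> \<open>A nonnegative measurable function with finite Lebesgue integral is also
    Henstock-Kurzweil integrable.\<close>
  have "(\<lambda>r. indicator {0..} r *\<^sub>R (F r * k r)) integrable_on UNIV"
    using meas fin' bounds k_nonneg by (intro nn_integral_integrable_on) (auto split: split_indicator)
  then have "(\<lambda>r. F r * k r) integrable_on {0..}"
    by (subst integrable_restrict_UNIV[symmetric]) (simp add: indicator_def of_bool_def if_distrib[of "\<lambda>x. x * y" for y] cong: if_cong)
  then obtain I where I: "((\<lambda>r. F r * k r) has_integral I) {0..}"
    by blast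
  have "((\<lambda>r. f r * ?h r + F r * k r) has_integral 0 - F 0 * ?h 0) {0..}"
  proof (rule has_integral_deriv_atLeast)
    show "((\<lambda>r. F r * ?h r) \<longlongrightarrow> 0) at_top"
      using tendsto_power_decay_arsinh_radial[OF bounds decay pos] .
    show "((\<lambda>r. F r * ?h r) has_real_derivative f r * ?h r + F r * k r) (at r within {0..})"
      if "0 \<le> r" for r
      using DERIV_mult'[OF deriv[OF that] arsinh_radial_deriv[OF pos, of r "{0..}"]]
      by (simp add: k_def algebra_simps)
  qed
  from has_integral_diff[OF this I]
  have fh: "((\<lambda>r. f r * ?h r) has_integral - F 0 * ?h 0 - I) {0..}" by simp
  then show "(\<lambda>r. f r * ?h r) integrable_on {0..}" by blast
  have I_eq: "- (F 0 * ?h 0 + integral {0..} (\<lambda>r. f r * ?h r)) = I"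
    using integral_unique[OF fh] by simp
  show "- (F 0 * ?h 0 + integral {0..} (\<lambda>r. f r * ?h r)) \<ge> 0"
    unfolding I_eq by (rule has_integral_nonneg[OF I]) (auto intro!: mult_nonneg_nonneg bounds k_nonneg)
  show "(\<integral>\<^sup>+r. ennreal (F r * k r) * indicator {0..} r \<partial>lborel)
      = ennreal (- (F 0 * ?h 0 + integral {0..} (\<lambda>r. f r * ?h r)))"
    unfolding I_eq by (rule nn_integral_has_integral_lebesgue'[OF _ I]) (auto intro!: mult_nonneg_nonneg bounds k_nonneg)
qed

subsection \<open>The mean interference in closed form\<close>

theorem theorem1:
  fixes M :: "'w measure"
    and \<Phi> :: "'w \<Rightarrow> (real^2) set"
    and g :: "'w \<Rightarrow> real^2 \<Rightarrow> real"
    and Q :: "real measure"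
    and F f :: "real \<Rightarrow> real"
    and lam c \<alpha> \<nu> :: real
    and y0 :: "real^2"
  assumes "prob_space M"
    and "0 < lam"
    and "\<And>r. 0 \<le> r \<Longrightarrow> 0 \<le> F r \<and> F r \<le> 1"
    and "\<And>r. 0 \<le> r \<Longrightarrow> (F has_real_derivative f r) (at r within {0..})"
    and "poisson_point_process M \<Phi> (isotropic_intensity lam F)"
    and "prob_space Q" and "sets Q = sets borel"
    and "AE t in Q. 0 \<le> t"
    and "has_bochner_integral Q (\<lambda>t. t) 1"
    and "iid_marks M \<Phi> g Q"
    and "0 < c" and "\<alpha> = 2" and "0 < norm y0"
    and "0 < \<nu>" and "decays_like_power F \<nu>"
  shows "interference \<Phi> g (path_loss c \<alpha>) y0 \<in> borel_measurable M \<and>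
         A2_integrand f y0 c integrable_on {0..} \<and>
         (\<integral>\<^sup>+\<omega>. interference \<Phi> g (path_loss c \<alpha>) y0 \<omega> \<partial>M) < \<infinity> \<and>
         enn2real (\<integral>\<^sup>+\<omega>. interference \<Phi> g (path_loss c \<alpha>) y0 \<omega> \<partial>M) = lam * A2 F f y0 c"
proof -
  define R where "R = norm y0"
  define l where "l = path_loss c \<alpha>"
  define k where "k r = 2 * r / sqrt ((c + r\<^sup>2 + R\<^sup>2)\<^sup>2 - 4 * r\<^sup>2 * R\<^sup>2)" for r
  define J where "J = - (F 0 * arsinh_radial R c 0 + integral {0..} (\<lambda>r. f r * arsinh_radial R c r))"
  have R: "0 < R" and c: "0 < c" and lam: "0 < lam" using assms by (auto simp: R_def)
  have F_nonneg: "0 \<le> F r" if "0 \<le> r" for r using assms(3) that by blast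
  \<comment> \<open>At the origin this relies on \<open>0 powr 2 = 0\<close>.\<close>
  have l_eq: "l (norm z) = inverse (c + (norm z)\<^sup>2)" for z :: "real^2"
    using \<open>\<alpha> = 2\<close> by (cases "z = 0") (auto simp: l_def path_loss_def)
  have l_meas: "l \<in> borel_measurable borel"
    unfolding l_def path_loss_def by measurable
  have l_nonneg: "0 \<le> l r" if "0 \<le> r" for r
    using c that by (simp add: l_def path_loss_def)
  have radial: "(\<lambda>r. f r * arsinh_radial R c r) integrable_on {0..}" "0 \<le> J"
    "(\<integral>\<^sup>+r. ennreal (F r * k r) * indicator {0..} r \<partial>lborel) = ennreal J"
    unfolding J_def k_def
    by (rule radial_integral_by_parts[OF F_nonneg assms(4) assms(15,14) R c]; assumption)+
  have integrand: "A2_integrand f y0 c = (\<lambda>r. f r * arsinh_radial R c r)"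
    by (simp add: A2_integrand_def arsinh_radial_def R_def fun_eq_iff)
  have A2: "A2 F f y0 c = pi * J"
    by (simp add: A2_def J_def integrand) (simp add: arsinh_radial_def R_def algebra_simps)
  have "continuous_on {0..} F"
    using assms(4) by (meson DERIV_continuous_on atLeast_iff)
  \<comment> \<open>\<open>F\<close> is controlled only on \<open>{0..}\<close>; its even extension
    is continuous on the whole line and agrees with \<open>F\<close> at every norm.\<close>
  then have "continuous_on UNIV (\<lambda>r. F \<bar>r\<bar>)"
    by (rule continuous_on_compose2) (auto intro!: continuous_intros)
  then have F_meas [measurable]: "(\<lambda>r. F \<bar>r\<bar>) \<in> borel_measurable borel"
    by (rule borel_measurable_continuous_onI)
  have dens: "(\<lambda>x::real^2. ennreal (lam * F (norm x))) \<in> borel_measurable lborel"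
    using measurable_compose[of norm lborel borel "\<lambda>r. ennreal (lam * F \<bar>r\<bar>)" borel] by simp
  have mean: "interference \<Phi> g l y0 \<in> borel_measurable M"
    "(\<integral>\<^sup>+\<omega>. interference \<Phi> g l y0 \<omega> \<partial>M) = (\<integral>\<^sup>+x. ennreal (l (norm (x - y0))) \<partial>isotropic_intensity lam F)"
    by (rule interference_mean[OF assms(1,5,10,8,9) l_meas l_nonneg]; assumption)+
  have k_nonneg: "0 \<le> k r" if "0 \<le> r" for r
    unfolding k_def radial_discriminant(2) using c that by auto
  have "(\<integral>\<^sup>+x. ennreal (l (norm (x - y0))) \<partial>isotropic_intensity lam F)
      = (\<integral>\<^sup>+x. ennreal (lam * F (norm x)) * ennreal (l (norm (x - y0))) \<partial>lborel)"
    unfolding isotropic_intensity_def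
    by (rule nn_integral_density[OF dens]) (simp add: l_eq)
  also have "\<dots> = (\<integral>\<^sup>+x. ennreal (lam * F \<bar>norm x\<bar>) * ennreal (inverse (c + (norm (x - y0))\<^sup>2)) \<partial>lborel)"
    by (simp add: l_eq)
  also have "\<dots> = ennreal pi * (\<integral>\<^sup>+r. ennreal (lam * F \<bar>r\<bar>) * ennreal (k r) * indicator {0..} r \<partial>lborel)"
    unfolding k_def R_def by (rule nn_integral_radial_kernel[where \<phi> = "\<lambda>r. ennreal (lam * F \<bar>r\<bar>)"]) (simp_all add: c)
  also have "(\<integral>\<^sup>+r. ennreal (lam * F \<bar>r\<bar>) * ennreal (k r) * indicator {0..} r \<partial>lborel)
      = (\<integral>\<^sup>+r. ennreal lam * (ennreal (F \<bar>r\<bar> * k r) * indicator {0..} r) \<partial>lborel)"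
    using lam by (intro nn_integral_cong)
      (auto simp: ennreal_mult'[symmetric] ennreal_mult''[symmetric] k_nonneg mult_ac split: split_indicator)
  also have "\<dots> = ennreal lam * (\<integral>\<^sup>+r. ennreal (F \<bar>r\<bar> * k r) * indicator {0..} r \<partial>lborel)"
    unfolding k_def by (rule nn_integral_cmult) measurable
  also have "(\<integral>\<^sup>+r. ennreal (F \<bar>r\<bar> * k r) * indicator {0..} r \<partial>lborel) = ennreal J"
    unfolding radial(3)[symmetric] by (intro nn_integral_cong) (auto split: split_indicator)
  also have "ennreal pi * (ennreal lam * ennreal J) = ennreal (lam * A2 F f y0 c)"
    using radial(2) lam by (simp add: A2 ennreal_mult'[symmetric] mult_ac)
  finally have "(\<integral>\<^sup>+\<omega>. interference \<Phi> g l y0 \<omega> \<partial>M) = ennreal (lam * A2 F f y0 c)"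
    using mean(2) by simp
  \<comment> \<open>\<open>ennreal\<close> sends negative reals to 0, so \<open>enn2real\<close>
    recovers the value only with this sign.\<close>
  moreover have "0 \<le> lam * A2 F f y0 c"
    using radial(2) lam by (simp add: A2)
  ultimately show ?thesis
    using mean(1) radial(1) by (simp add: integrand l_def)
qed

end
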